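(* Let $X$ be a real Banach space. If $X$ has the Krein--Milman property, and if every extreme point of $B_X$ is a denting point of $B_X$, then $X$ contains no relative Daugavet-point.
   Context: All Banach spaces are real. $B_X$ and $S_X$ denote the closed unit ball and unit sphere of $X$. A slice of $B_X$ is a set of the form $S(x^*,\alpha)=\{y\in B_X:\ x^*(y)>\sup x^*(B_X)-\alpha\}$ with $x^*\in X^*$ and $\alpha>0$. For $x\in S_X$ let $D(x)=\{x^*\in S_{X^*}:\ x^*(x)=1\}$; a supporting slice at $x$ is a slice $S(x^*,\alpha)$ with $x^*\in D(x)$ and $\alpha>0$. A point $x\in S_X$ is a Daugavet-point relative to a supporting slice $S$ at $x$ if $\sup_{y\in T}\|x-y\|=2$ for every slice $T$ of $B_X$ with $T\subseteq S$. A point $x\in S_X$ is a relative Daugavet-point if it is a Daugavet-point relative to some supporting slice at $x$. A point of $B_X$ is a denting point of $B_X$ if it is contained in slices of $B_X$ of arbitrarily small diameter. $X$ has the Krein--Milman property (KMP) if every non-empty closed bounded convex subset of $X$ has an extreme point (equivalently, is the closed convex hull of its extreme points). *)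

theory Defs
  imports "HOL-Analysis.Analysis"
begin

text \<open>The dual space of \<open>'a\<close> is the library type \<open>'a \<Rightarrow>\<^sub>L real\<close> with its operator norm.\<close>

definition slice :: "('a::real_normed_vector \<Rightarrow>\<^sub>L real) \<Rightarrow> real \<Rightarrow> 'a set" where
  "slice f \<alpha> = {y \<in> cball 0 1. blinfun_apply f y > (SUP z\<in>cball 0 1. blinfun_apply f z) - \<alpha>}"

text \<open>The functional is arbitrary; in particular \<open>f = 0\<close> is allowed and gives the whole ball.\<close>

definition is_slice :: "'a::real_normed_vector set \<Rightarrow> bool" where
  "is_slice S \<longleftrightarrow> (\<exists>f \<alpha>. \<alpha> > 0 \<and> S = slice f \<alpha>)"

definition support_functionals :: "'a::real_normed_vector \<Rightarrow> ('a \<Rightarrow>\<^sub>L real) set" where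
  "support_functionals x = {f \<in> sphere 0 1. blinfun_apply f x = 1}"

definition supporting_slice :: "'a::real_normed_vector \<Rightarrow> 'a set \<Rightarrow> bool" where
  "supporting_slice x S \<longleftrightarrow> (\<exists>f\<in>support_functionals x. \<exists>\<alpha>>0. S = slice f \<alpha>)"

text \<open>Slices are non-empty and bounded, so the real-valued supremum below is the usual one.\<close>

definition daugavet_point_relative :: "'a::real_normed_vector \<Rightarrow> 'a set \<Rightarrow> bool" where
  "daugavet_point_relative x S \<longleftrightarrow>
     x \<in> sphere 0 1 \<and> supporting_slice x S \<and>
     (\<forall>T. is_slice T \<and> T \<subseteq> S \<longrightarrow> (SUP y\<in>T. norm (x - y)) = 2)"

definition relative_daugavet_point :: "'a::real_normed_vector \<Rightarrow> bool" where
  "relative_daugavet_point x \<longleftrightarrow> (\<exists>S. daugavet_point_relative x S)"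

definition denting_point_of_ball :: "'a::real_normed_vector \<Rightarrow> bool" where
  "denting_point_of_ball x \<longleftrightarrow>
     x \<in> cball 0 1 \<and> (\<forall>\<epsilon>>0. \<exists>S. is_slice S \<and> x \<in> S \<and> diameter S < \<epsilon>)"

definition krein_milman_property :: "'a::real_normed_vector itself \<Rightarrow> bool" where
  "krein_milman_property _ \<longleftrightarrow>
     (\<forall>C::'a set. C \<noteq> {} \<and> closed C \<and> bounded C \<and> convex C \<longrightarrow> (\<exists>x. x extreme_point_of C))"

end

theory Submission
  imports Defs
begin

text \<open>
  Let \<open>x\<close> be a unit vector and let \<open>F\<close> be the set of all \<open>z\<close> in the unit ball with \<open>g z = 1\<close> for
  every \<open>g \<in> D(x)\<close>. It is an intersection of closed faces of the ball and contains \<open>x\<close>, so by the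
  Krein--Milman property it has an extreme point \<open>y\<close>, which is then an extreme point of the ball and
  by hypothesis a denting point. No point of \<open>F\<close> is at distance \<open>2\<close> from \<open>x\<close>: a norm-one
  functional \<open>g\<close> with \<open>g (x - y) = 2\<close> would satisfy \<open>g x = 1\<close> and \<open>g y = -1\<close>, although \<open>y \<in> F\<close>.
  On the other hand \<open>y\<close> lies in every supporting slice at \<open>x\<close>, so inside any such slice there are
  slices of tiny diameter around \<open>y\<close>, whose points all stay at distance bounded away from \<open>2\<close>
  from \<open>x\<close>. Hence \<open>x\<close> is not a Daugavet-point relative to any supporting slice.

  The face \<open>F\<close> can be described by the norm alone, and it enters the proof in this form: the
  one-sided derivative of \<open>t \<mapsto> \<parallel>x - t z\<parallel>\<close> at \<open>0\<close> is the maximum of \<open>- g z\<close> over \<open>g \<in> D(x)\<close>, so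
  \<open>z \<in> F\<close> means that this derivative has its least possible value \<open>-1\<close>. From this description the
  face property (\<open>tangent_face_is_face\<close>), closedness (\<open>closed_tangent_face\<close>) and the distance
  bound (\<open>dist_tangent_face_less_2\<close>) follow by the triangle inequality, and applying \<open>g\<close> to
  \<open>x - t z\<close> gives back \<open>g z = 1\<close> (\<open>tangent_face_support_functional\<close>).
\<close>

text \<open>
  For a unit vector \<open>x\<close> the lower bound \<open>1 - t \<le> \<parallel>x - t z\<parallel>\<close> is automatic, so the condition says that
  \<open>\<parallel>x - t z\<parallel> = 1 - t + o(t)\<close> as \<open>t\<close> decreases to \<open>0\<close>; these are the \<open>z\<close> in the ball at which every
  \<open>g \<in> D(x)\<close> takes the value \<open>1\<close>.
\<close>

definition tangent_face :: "'a::real_normed_vector \<Rightarrow> 'a set" where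
  "tangent_face x = {z \<in> cball 0 1.
     \<forall>\<epsilon>>0. \<exists>\<delta>>0. \<forall>t. 0 < t \<and> t \<le> \<delta> \<longrightarrow> norm (x - t *\<^sub>R z) \<le> 1 - t + \<epsilon> * t}"

lemma tangent_faceD:
  assumes "z \<in> tangent_face x" "\<epsilon> > 0"
  obtains \<delta> where "\<delta> > 0" "\<And>t. 0 < t \<Longrightarrow> t \<le> \<delta> \<Longrightarrow> norm (x - t *\<^sub>R z) \<le> 1 - t + \<epsilon> * t"
  using assms unfolding tangent_face_def by blast

lemma mem_tangent_face_self:
  assumes "norm x = 1"
  shows "x \<in> tangent_face x"
proof -
  have "norm (x - t *\<^sub>R x) \<le> 1 - t + \<epsilon> * t" if "\<epsilon> > 0" "0 < t" "t \<le> 1" for \<epsilon> t :: real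
  proof -
    have "x - t *\<^sub>R x = (1 - t) *\<^sub>R x" by (simp add: algebra_simps)
    then show ?thesis using that assms by simp
  qed
  then show ?thesis
    using assms unfolding tangent_face_def by (auto intro!: exI[of _ 1])
qed

lemma closed_tangent_face: "closed (tangent_face x)"
proof -
  have "z \<in> tangent_face x" if z: "z \<in> closure (tangent_face x)" for z
  proof -
    have "z \<in> cball 0 1"
      using z closure_minimal[OF _ closed_cball, of "tangent_face x" 0 1]
      unfolding tangent_face_def by blast
    moreover have "\<exists>\<delta>>0. \<forall>t. 0 < t \<and> t \<le> \<delta> \<longrightarrow> norm (x - t *\<^sub>R z) \<le> 1 - t + \<epsilon> * t"
      if "\<epsilon> > 0" for \<epsilon>
    proof -
      have "\<epsilon> / 2 > 0" using that by simp
      then obtain w where w: "w \<in> tangent_face x" "dist w z < \<epsilon> / 2"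
        using z closure_approachable by blast
      obtain \<delta> where \<delta>: "\<delta> > 0"
          "\<And>t. 0 < t \<Longrightarrow> t \<le> \<delta> \<Longrightarrow> norm (x - t *\<^sub>R w) \<le> 1 - t + \<epsilon> / 2 * t"
        using tangent_faceD[OF w(1) \<open>\<epsilon> / 2 > 0\<close>] by blast
      have "norm (x - t *\<^sub>R z) \<le> 1 - t + \<epsilon> * t" if "0 < t" "t \<le> \<delta>" for t
      proof -
        have "x - t *\<^sub>R z = (x - t *\<^sub>R w) + t *\<^sub>R (w - z)" by (simp add: algebra_simps)
        then have "norm (x - t *\<^sub>R z) \<le> norm (x - t *\<^sub>R w) + norm (t *\<^sub>R (w - z))"
          by (metis norm_triangle_ineq)
        also have "\<dots> = norm (x - t *\<^sub>R w) + t * dist w z"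
          using that by (simp add: dist_norm)
        also have "\<dots> \<le> (1 - t + \<epsilon> / 2 * t) + t * (\<epsilon> / 2)"
          using \<delta>(2)[OF that] w(2) that by (intro add_mono mult_left_mono) auto
        also have "\<dots> = 1 - t + \<epsilon> * t" by simp
        finally show ?thesis .
      qed
      then show ?thesis using \<delta>(1) by blast
    qed
    ultimately show ?thesis unfolding tangent_face_def by blast
  qed
  then show ?thesis using closure_subset_eq by blast
qed

lemma convex_tangent_face: "convex (tangent_face x)"
proof (rule convexI)
  fix a b :: 'a and u v :: real
  assume ab: "a \<in> tangent_face x" "b \<in> tangent_face x" and uv: "0 \<le> u" "0 \<le> v" "u + v = 1"
  let ?m = "u *\<^sub>R a + v *\<^sub>R b"
  have "?m \<in> cball 0 1"
    using ab uv by (intro convexD[OF convex_cball]) (auto simp: tangent_face_def)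
  moreover have "\<exists>\<delta>>0. \<forall>t. 0 < t \<and> t \<le> \<delta> \<longrightarrow> norm (x - t *\<^sub>R ?m) \<le> 1 - t + \<epsilon> * t"
    if \<epsilon>: "\<epsilon> > 0" for \<epsilon>
  proof -
    obtain d where d: "d > 0"
        "\<And>t. 0 < t \<Longrightarrow> t \<le> d \<Longrightarrow> norm (x - t *\<^sub>R a) \<le> 1 - t + \<epsilon> * t"
      using tangent_faceD[OF ab(1) \<epsilon>] by blast
    obtain e where e: "e > 0"
        "\<And>t. 0 < t \<Longrightarrow> t \<le> e \<Longrightarrow> norm (x - t *\<^sub>R b) \<le> 1 - t + \<epsilon> * t"
      using tangent_faceD[OF ab(2) \<epsilon>] by blast
    have "norm (x - t *\<^sub>R ?m) \<le> 1 - t + \<epsilon> * t" if t: "0 < t" "t \<le> min d e" for t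
    proof -
      have "x - t *\<^sub>R ?m = (u + v) *\<^sub>R x - t *\<^sub>R ?m" using uv by simp
      also have "\<dots> = u *\<^sub>R (x - t *\<^sub>R a) + v *\<^sub>R (x - t *\<^sub>R b)"
        by (simp add: algebra_simps)
      finally have "norm (x - t *\<^sub>R ?m) \<le> u * norm (x - t *\<^sub>R a) + v * norm (x - t *\<^sub>R b)"
        using uv norm_triangle_ineq[of "u *\<^sub>R (x - t *\<^sub>R a)" "v *\<^sub>R (x - t *\<^sub>R b)"] by simp
      also have "\<dots> \<le> 1 - t + \<epsilon> * t"
        using convex_bound_le[OF d(2) e(2) uv, of t] t by simp
      finally show ?thesis .
    qed
    then show ?thesis using d(1) e(1) by (intro exI[of _ "min d e"]) auto
  qed
  ultimately show "?m \<in> tangent_face x" unfolding tangent_face_def by blast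
qed

text \<open>
  If \<open>m = (1 - u) a + u b\<close> and \<open>s = t / (1 - u)\<close>, then \<open>x - t a = (x - s m) + s u b\<close>. The first
  summand has norm at most \<open>1 - s + o(s)\<close> and the second at most \<open>s u\<close>; together this is
  \<open>1 - t + o(t)\<close>. In terms of functionals: \<open>g m = 1\<close> forces \<open>g a = 1\<close> because \<open>g b \<le> 1\<close>.
\<close>

lemma tangent_face_segment_endpoint:
  assumes m: "(1 - u) *\<^sub>R a + u *\<^sub>R b \<in> tangent_face x"
    and u: "0 \<le> u" "u < 1" and a: "norm a \<le> 1" and b: "norm b \<le> 1"
  shows "a \<in> tangent_face x"
proof -
  let ?m = "(1 - u) *\<^sub>R a + u *\<^sub>R b"
  have "\<exists>\<delta>>0. \<forall>t. 0 < t \<and> t \<le> \<delta> \<longrightarrow> norm (x - t *\<^sub>R a) \<le> 1 - t + \<epsilon> * t" if "\<epsilon> > 0" for \<epsilon>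
  proof -
    have "\<epsilon> * (1 - u) > 0" using that u by simp
    then obtain d where d: "d > 0"
        "\<And>s. 0 < s \<Longrightarrow> s \<le> d \<Longrightarrow> norm (x - s *\<^sub>R ?m) \<le> 1 - s + \<epsilon> * (1 - u) * s"
      using tangent_faceD[OF m] by blast
    have "norm (x - t *\<^sub>R a) \<le> 1 - t + \<epsilon> * t" if t: "0 < t" "t \<le> d * (1 - u)" for t
    proof -
      define s where "s = t / (1 - u)"
      have s: "0 < s" "s \<le> d" "t = s * (1 - u)"
        using t u by (auto simp: s_def field_simps)
      have "x - t *\<^sub>R a = (x - s *\<^sub>R ?m) + (s * u) *\<^sub>R b"
        by (simp add: s(3) algebra_simps)
      then have "norm (x - t *\<^sub>R a) \<le> norm (x - s *\<^sub>R ?m) + norm ((s * u) *\<^sub>R b)"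
        by (metis norm_triangle_ineq)
      also have "\<dots> = norm (x - s *\<^sub>R ?m) + (s * u) * norm b"
        using s u by simp
      also have "\<dots> \<le> (1 - s + \<epsilon> * (1 - u) * s) + (s * u) * 1"
        using d(2)[OF s(1,2)] b s u by (intro add_mono mult_left_mono) auto
      also have "\<dots> = 1 - t + \<epsilon> * t"
        by (simp add: s(3) algebra_simps)
      finally show ?thesis .
    qed
    then show ?thesis using d(1) u by (intro exI[of _ "d * (1 - u)"]) auto
  qed
  then show ?thesis using a unfolding tangent_face_def by auto
qed

lemma tangent_face_is_face: "tangent_face x face_of cball 0 1"
  unfolding face_of_def
proof (intro conjI ballI impI)
  show "tangent_face x \<subseteq> cball 0 1" by (auto simp: tangent_face_def)
  show "convex (tangent_face x)" by (rule convex_tangent_face)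
next
  fix a b m
  assume ab: "a \<in> cball 0 1" "b \<in> cball 0 1" and m: "m \<in> tangent_face x" "m \<in> open_segment a b"
  then obtain u where u: "0 < u" "u < 1" "m = (1 - u) *\<^sub>R a + u *\<^sub>R b"
    by (auto simp: in_segment)
  show "a \<in> tangent_face x"
    using tangent_face_segment_endpoint[of u a b x] m ab u by simp
  show "b \<in> tangent_face x"
    using tangent_face_segment_endpoint[of "1 - u" b a x] m ab u by (simp add: add.commute)
qed

text \<open>
  If \<open>\<parallel>x - t y\<parallel> < 1\<close> for some \<open>t \<in> (0, 1]\<close>, then splitting \<open>x - y = (x - t y) - (1 - t) y\<close> already
  beats the trivial bound \<open>2\<close>.
\<close>

lemma dist_tangent_face_less_2:
  assumes "y \<in> tangent_face x"
  shows "norm (x - y) < 2"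
proof -
  obtain d where d: "d > 0" "\<And>t. 0 < t \<Longrightarrow> t \<le> d \<Longrightarrow> norm (x - t *\<^sub>R y) \<le> 1 - t + 1/2 * t"
    using tangent_faceD[OF assms, of "1/2"] by auto
  define t where "t = min d 1"
  have t: "0 < t" "t \<le> d" "t \<le> 1" using d(1) by (auto simp: t_def)
  have y: "norm y \<le> 1" using assms by (simp add: tangent_face_def)
  have "x - y = (x - t *\<^sub>R y) - (1 - t) *\<^sub>R y" by (simp add: algebra_simps)
  then have "norm (x - y) \<le> norm (x - t *\<^sub>R y) + norm ((1 - t) *\<^sub>R y)"
    by (metis norm_triangle_ineq4)
  also have "\<dots> = norm (x - t *\<^sub>R y) + (1 - t) * norm y"
    using t by simp
  also have "\<dots> \<le> (1 - t + 1/2 * t) + (1 - t) * 1"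
    using d(2)[OF t(1,2)] y t by (intro add_mono mult_left_mono) auto
  also have "\<dots> < 2" using t by simp
  finally show ?thesis .
qed

lemma support_functional_le_norm:
  assumes "f \<in> support_functionals x"
  shows "blinfun_apply f z \<le> norm z"
  using norm_blinfun[of f z] assms by (simp add: support_functionals_def)

lemma tangent_face_support_functional:
  assumes y: "y \<in> tangent_face x" and f: "f \<in> support_functionals x"
  shows "blinfun_apply f y = 1"
proof (rule antisym)
  show "blinfun_apply f y \<le> 1"
    using support_functional_le_norm[OF f, of y] y by (simp add: tangent_face_def)
  show "1 \<le> blinfun_apply f y"
  proof (rule field_le_epsilon)
    fix \<epsilon> :: real assume "\<epsilon> > 0"
    then obtain t where t: "t > 0" "norm (x - t *\<^sub>R y) \<le> 1 - t + \<epsilon> * t"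
      using tangent_faceD[OF y] by blast
    have "1 - t * blinfun_apply f y = blinfun_apply f (x - t *\<^sub>R y)"
      using f by (simp add: support_functionals_def blinfun.diff_right blinfun.scaleR_right)
    also have "\<dots> \<le> 1 - t + \<epsilon> * t"
      using support_functional_le_norm[OF f, of "x - t *\<^sub>R y"] t(2) by simp
    finally have "t * 1 \<le> t * (blinfun_apply f y + \<epsilon>)" by (simp add: algebra_simps)
    then show "1 \<le> blinfun_apply f y + \<epsilon>" using t(1) by simp
  qed
qed

lemma slice_support_functional:
  assumes x: "norm x = 1" and f: "f \<in> support_functionals x"
  shows "slice f \<alpha> = {y \<in> cball 0 1. blinfun_apply f y > 1 - \<alpha>}"
proof -
  have "(SUP z\<in>cball 0 1. blinfun_apply f z) = 1"
  proof (rule cSup_eq_maximum)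
    show "1 \<in> blinfun_apply f ` cball 0 1"
      using x f by (auto simp: support_functionals_def image_iff intro!: bexI[of _ x])
    show "r \<le> 1" if "r \<in> blinfun_apply f ` cball 0 1" for r
      using that support_functional_le_norm[OF f] by (force intro: order_trans)
  qed
  then show ?thesis by (simp add: slice_def)
qed

text \<open>
  A slice of diameter less than \<open>\<alpha>\<close> around a point where \<open>f = 1\<close> stays inside \<open>slice f \<alpha>\<close>, since
  \<open>f\<close> is \<open>1\<close>-Lipschitz; and its points are within its diameter of that point, so the supremum
  demanded of a relative Daugavet-point cannot exceed the distance to it by more than the diameter.
\<close>

lemma daugavet_point_dist_denting_point:
  assumes x: "norm x = 1" and f: "f \<in> support_functionals x" and "\<alpha> > 0"
    and daugavet: "\<And>T. is_slice T \<Longrightarrow> T \<subseteq> slice f \<alpha> \<Longrightarrow> (SUP y\<in>T. norm (x - y)) = 2"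
    and y: "denting_point_of_ball y" "blinfun_apply f y = 1"
  shows "2 \<le> norm (x - y)"
proof (rule field_le_epsilon)
  fix \<epsilon> :: real assume "\<epsilon> > 0"
  then have "min \<epsilon> \<alpha> > 0" using \<open>\<alpha> > 0\<close> by simp
  then obtain T where T: "is_slice T" "y \<in> T" "diameter T < min \<epsilon> \<alpha>"
    using y(1) unfolding denting_point_of_ball_def by blast
  have ball: "T \<subseteq> cball 0 1" using T(1) by (auto simp: is_slice_def slice_def)
  then have "bounded T" using bounded_cball bounded_subset by blast
  then have near: "norm (y - z) < min \<epsilon> \<alpha>" if "z \<in> T" for z
    using diameter_bounded_bound[of T y z] T that by (simp add: dist_norm)
  have "T \<subseteq> slice f \<alpha>"
  proof
    fix z assume z: "z \<in> T"
    have "1 - blinfun_apply f z = blinfun_apply f (y - z)"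
      using y(2) by (simp add: blinfun.diff_right)
    also have "\<dots> < \<alpha>"
      using support_functional_le_norm[OF f, of "y - z"] near[OF z] by simp
    finally show "z \<in> slice f \<alpha>"
      using z ball by (auto simp: slice_support_functional[OF x f])
  qed
  then have "2 = (SUP z\<in>T. norm (x - z))" using daugavet T(1) by simp
  also have "\<dots> \<le> norm (x - y) + \<epsilon>"
  proof (rule cSUP_least)
    show "T \<noteq> {}" using T(2) by blast
    show "norm (x - z) \<le> norm (x - y) + \<epsilon>" if "z \<in> T" for z
      using norm_triangle_ineq[of "x - y" "y - z"] near[OF that] by simp
  qed
  finally show "2 \<le> norm (x - y) + \<epsilon>" .
qed

theorem theorem3p24:
  assumes "krein_milman_property TYPE('a::banach)"
    and "\<And>x::'a. x extreme_point_of cball 0 1 \<Longrightarrow> denting_point_of_ball x"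
  shows "\<not> (\<exists>x::'a. relative_daugavet_point x)"
proof
  assume "\<exists>x::'a. relative_daugavet_point x"
  then obtain x :: 'a and f \<alpha> where x: "norm x = 1"
      and f: "f \<in> support_functionals x" and "\<alpha> > 0"
      and daugavet: "\<And>T. is_slice T \<Longrightarrow> T \<subseteq> slice f \<alpha> \<Longrightarrow> (SUP y\<in>T. norm (x - y)) = 2"
    unfolding relative_daugavet_point_def daugavet_point_relative_def supporting_slice_def
    by auto
  have "bounded (tangent_face x)"
    using bounded_subset[OF bounded_cball face_of_imp_subset[OF tangent_face_is_face]] .
  then obtain y where y: "y extreme_point_of tangent_face x"
    using assms(1) mem_tangent_face_self[OF x] closed_tangent_face[of x] convex_tangent_face[of x]
    unfolding krein_milman_property_def by blast
  then have mem: "y \<in> tangent_face x" and "y extreme_point_of cball 0 1"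
    using extreme_point_of_face[OF tangent_face_is_face] by blast+
  then have "denting_point_of_ball y" using assms(2) by blast
  then have "2 \<le> norm (x - y)"
    using daugavet_point_dist_denting_point[OF x f \<open>\<alpha> > 0\<close> daugavet]
      tangent_face_support_functional[OF mem f] by blast
  with dist_tangent_face_less_2[OF mem] show False by simp
qed

end
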